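(* Let $\gamma^*>0$, $d_*>0$ and $\beta^*<\pi$ be given. There exists a constant $K>0$, depending only on $\gamma^*,d_*,\beta^*$, such that for every convex polygon $\Omega$ of diameter one satisfying G1 (bounded aspect ratio): $\gamma<\gamma^*$, G2 (minimum edge length): $|\mathbf{v}_i-\mathbf{v}_j|>d_*$ for all $i\neq j$, G3 (maximum interior angle): $\beta_i<\beta^*$ for all $i$, the matrix $\mathbb{A}=[c^{ij}_{ab}]$ (rows $ij\in V\cup E$, columns $ab\in I$) associated with $\Omega$ by the generic-polygon construction described in the context satisfies $\|\mathbb{A}\|\le K$, where $\|\mathbb{A}\|:=\max_{ij}\sum_{ab}|c^{ij}_{ab}|$.
   Context: $\Omega$ has vertices $\mathbf{v}_1,\dots,\mathbf{v}_n$ ordered counter-clockwise (the number $n$ of vertices is not fixed); $\beta_i$ is the interior angle at $\mathbf{v}_i$, and the aspect ratio is $\gamma:=\operatorname{diam}(\Omega)/\rho(\Omega)$, where $\rho(\Omega)$ is the radius of the largest inscribed circle. Vertex indices are taken modulo $n$. Index sets: $I=\{\{a,b\}: a,b\in\{1,\dots,n\}\}$ is the set of unordered, possibly non-distinct pairs; $V=\{\{a,a\}\}$, $E=\{\{a,a+1\}: a=1,\dots,n\}$, $D=I\setminus(V\cup E)$. One writes $ab$ for $\{a,b\}$. Coefficients. For $ab\in V\cup E$: $c^{ij}_{ab}=1$ if $ij=ab$ and $c^{ij}_{ab}=0$ otherwise ($ij\in V\cup E$). For $ab\in D$: apply a rigid motion (rotation and translation) of the plane so that $\mathbf{v}_a=(-\ell,0)$,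 $\mathbf{v}_b=(\ell,0)$ with $\ell>0$. In these coordinates (subscripts $x,y$ denote components) define $$d_a:=\frac{(\mathbf{v}_{a-1})_x(\mathbf{v}_{a+1})_y-(\mathbf{v}_{a+1})_x(\mathbf{v}_{a-1})_y}{(\mathbf{v}_{a-1})_y-(\mathbf{v}_{a+1})_y}\cdot\frac1\ell,\qquad d_b:=\frac{(\mathbf{v}_{b+1})_x(\mathbf{v}_{b-1})_y-(\mathbf{v}_{b-1})_x(\mathbf{v}_{b+1})_y}{(\mathbf{v}_{b-1})_y-(\mathbf{v}_{b+1})_y}\cdot\frac1\ell,$$ (so $-d_a\ell$ and $d_b\ell$ are the $x$-intercepts of the lines through $\mathbf{v}_{a-1},\mathbf{v}_{a+1}$ and through $\mathbf{v}_{b-1},\mathbf{v}_{b+1}$), and $s:=\frac{2}{2-(d_a+d_b)}$. Then $c^{(a-1)a}_{ab},c^{a(a+1)}_{ab}$ are the unique solution of $$c^{(a-1)a}_{ab}+c^{a(a+1)}_{ab}=s,\qquad c^{(a-1)a}_{ab}\mathbf{v}_{a-1}+c^{a(a+1)}_{ab}\mathbf{v}_{a+1}=s\,d_a\mathbf{v}_a,$$ $c^{(b-1)b}_{ab},c^{b(b+1)}_{ab}$ are the unique solution of $$c^{(b-1)b}_{ab}+c^{b(b+1)}_{ab}=s,\qquad c^{(b-1)b}_{ab}\mathbf{v}_{b-1}+c^{b(b+1)}_{ab}\mathbf{v}_{b+1}=s\,d_b\mathbf{v}_b,$$ $$c^{aa}_{ab}=\frac{-2-2d_a}{2-(d_a+d_b)},\qquad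 c^{bb}_{ab}=\frac{-2-2d_b}{2-(d_a+d_b)},$$ and all other $c^{ij}_{ab}$ with $ij\in V\cup E$ are $0$. *)

theory Defs
  imports "HOL-Analysis.Analysis"
begin

text \<open>The plane is \<^typ>\<open>complex\<close>, so the components of a point are \<^const>\<open>Re\<close> and \<^const>\<open>Im\<close> and
  rigid motions are the maps z \<mapsto> u z + t with |u| = 1. The vertices are v 0, ..., v (n - 1)
  with cyclic indices.\<close>

definition nxt :: "nat \<Rightarrow> nat \<Rightarrow> nat" where
  "nxt n i = (i + 1) mod n"

definition prv :: "nat \<Rightarrow> nat \<Rightarrow> nat" where
  "prv n i = (i + n - 1) mod n"

definition polygon :: "nat \<Rightarrow> (nat \<Rightarrow> complex) \<Rightarrow> complex set" where
  "polygon n v = convex hull (v ` {..<n})"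

text \<open>\<^term>\<open>Im (cnj p * q)\<close> is the cross product of p and q: every vertex other than the two
  end points of a directed edge lies strictly to the left of that edge. In particular the
  vertices are distinct, run around the boundary once, and no interior angle is straight.\<close>

definition convex_polygon_ccw :: "nat \<Rightarrow> (nat \<Rightarrow> complex) \<Rightarrow> bool" where
  "convex_polygon_ccw n v \<longleftrightarrow> 3 \<le> n \<and>
     (\<forall>i<n. \<forall>j<n. j \<noteq> i \<and> j \<noteq> nxt n i \<longrightarrow>
        0 < Im (cnj (v (nxt n i) - v i) * (v j - v i)))"

text \<open>The counter-clockwise angle from the outgoing edge at vertex i to the incoming one, seen
  from vertex i.\<close>

definition interior_angle :: "nat \<Rightarrow> (nat \<Rightarrow> complex) \<Rightarrow> nat \<Rightarrow> real" where
  "interior_angle n v i = Arg2pi ((v (prv n i) - v i) / (v (nxt n i) - v i))"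

definition inradius :: "complex set \<Rightarrow> real" where
  "inradius S = Sup {r. 0 \<le> r \<and> (\<exists>x. cball x r \<subseteq> S)}"

definition aspect_ratio :: "complex set \<Rightarrow> real" where
  "aspect_ratio S = diameter S / inradius S"

definition I_set :: "nat \<Rightarrow> nat set set" where
  "I_set n = {{a, b} |a b. a < n \<and> b < n}"

definition V_set :: "nat \<Rightarrow> nat set set" where
  "V_set n = {{a, a} |a. a < n}"

definition E_set :: "nat \<Rightarrow> nat set set" where
  "E_set n = {{a, nxt n a} |a. a < n}"

definition D_set :: "nat \<Rightarrow> nat set set" where
  "D_set n = I_set n - (V_set n \<union> E_set n)"

definition rigid_motion :: "(complex \<Rightarrow> complex) \<Rightarrow> bool" where
  "rigid_motion T \<longleftrightarrow> (\<exists>u t. cmod u = 1 \<and> T = (\<lambda>z. u * z + t))"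

text \<open>The coordinates in which p = (-l, 0) and q = (l, 0) with l > 0.\<close>

definition diag_frame :: "complex \<Rightarrow> complex \<Rightarrow> complex \<Rightarrow> complex" where
  "diag_frame p q = (THE T. rigid_motion T \<and>
     (\<exists>l::real. 0 < l \<and> T p = - complex_of_real l \<and> T q = complex_of_real l))"

definition diag_l :: "complex \<Rightarrow> complex \<Rightarrow> real" where
  "diag_l p q = Re (diag_frame p q q)"

definition d_a :: "nat \<Rightarrow> (nat \<Rightarrow> complex) \<Rightarrow> nat \<Rightarrow> nat \<Rightarrow> real" where
  "d_a n v a b =
     (let w = diag_frame (v a) (v b) \<circ> v
      in (Re (w (prv n a)) * Im (w (nxt n a)) - Re (w (nxt n a)) * Im (w (prv n a)))
         / (Im (w (prv n a)) - Im (w (nxt n a))) * (1 / diag_l (v a) (v b)))"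

definition d_b :: "nat \<Rightarrow> (nat \<Rightarrow> complex) \<Rightarrow> nat \<Rightarrow> nat \<Rightarrow> real" where
  "d_b n v a b =
     (let w = diag_frame (v a) (v b) \<circ> v
      in (Re (w (nxt n b)) * Im (w (prv n b)) - Re (w (prv n b)) * Im (w (nxt n b)))
         / (Im (w (prv n b)) - Im (w (nxt n b))) * (1 / diag_l (v a) (v b)))"

definition diag_s :: "nat \<Rightarrow> (nat \<Rightarrow> complex) \<Rightarrow> nat \<Rightarrow> nat \<Rightarrow> real" where
  "diag_s n v a b = 2 / (2 - (d_a n v a b + d_b n v a b))"

definition edge_coeffs :: "real \<Rightarrow> real \<Rightarrow> complex \<Rightarrow> complex \<Rightarrow> complex \<Rightarrow> real \<times> real" where
  "edge_coeffs s d p m q =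
     (THE c. fst c + snd c = s \<and> fst c *\<^sub>R p + snd c *\<^sub>R q = (s * d) *\<^sub>R m)"

text \<open>The column of a diagonal, for a chosen order of its end points. For a diagonal of a convex
  polygon the six row indices below are distinct, and the order does not matter
  (\<open>diag_coeff_swap\<close>).\<close>

definition diag_coeff :: "nat \<Rightarrow> (nat \<Rightarrow> complex) \<Rightarrow> nat \<Rightarrow> nat \<Rightarrow> nat set \<Rightarrow> real" where
  "diag_coeff n v a b ij =
     (let w = diag_frame (v a) (v b) \<circ> v;
          da = d_a n v a b; db = d_b n v a b; s = diag_s n v a b;
          ca = edge_coeffs s da (w (prv n a)) (w a) (w (nxt n a));
          cb = edge_coeffs s db (w (prv n b)) (w b) (w (nxt n b))
      in if ij = {prv n a, a} then fst ca
         else if ij = {a, nxt n a} then snd ca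
         else if ij = {prv n b, b} then fst cb
         else if ij = {b, nxt n b} then snd cb
         else if ij = {a, a} then (- 2 - 2 * da) / (2 - (da + db))
         else if ij = {b, b} then (- 2 - 2 * db) / (2 - (da + db))
         else 0)"

definition coeff_matrix :: "nat \<Rightarrow> (nat \<Rightarrow> complex) \<Rightarrow> nat set \<Rightarrow> nat set \<Rightarrow> real" where
  "coeff_matrix n v ij ab =
     (if ab \<in> V_set n \<union> E_set n then (if ij = ab then 1 else 0)
      else diag_coeff n v (Min ab) (Max ab) ij)"

definition matrix_norm :: "nat \<Rightarrow> (nat set \<Rightarrow> nat set \<Rightarrow> real) \<Rightarrow> real" where
  "matrix_norm n A = Max ((\<lambda>ij. \<Sum>ab\<in>I_set n. \<bar>A ij ab\<bar>) ` (V_set n \<union> E_set n))"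


lemma diag_frame_unique:
  assumes "p \<noteq> q"
  shows "\<exists>!T. rigid_motion T \<and>
     (\<exists>l::real. 0 < l \<and> T p = - complex_of_real l \<and> T q = complex_of_real l)"
    (is "\<exists>!T. ?P T")
proof (rule ex_ex1I)
  define r where "r = cmod (q - p)"
  have r: "r > 0" using assms by (simp add: r_def)
  define u where "u = cnj (q - p) / r"
  have uq: "u * (q - p) = r"
    using r complex_norm_square[of "q - p"]
    by (simp add: u_def r_def field_simps power2_eq_square del: complex_cnj_diff)
  have cu: "cmod u = 1" using r by (simp add: u_def norm_divide r_def del: complex_cnj_diff)
  have "?P (\<lambda>z. u * z + - u * ((p + q) / 2))"
    unfolding rigid_motion_def
    using cu r uq by (intro conjI exI[of _ u] exI[of _ "- u * ((p + q) / 2)"] exI[of _ "r / 2"])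
      (auto simp: field_simps)
  then show "\<exists>T. ?P T" by blast
next
  fix T T' assume "?P T" "?P T'"
  then obtain u t l u' t' l' where *: "cmod u = 1" "T = (\<lambda>z. u * z + t)" "0 < l"
      "u * p + t = - complex_of_real l" "u * q + t = complex_of_real l"
      "cmod u' = 1" "T' = (\<lambda>z. u' * z + t')" "0 < l'"
      "u' * p + t' = - complex_of_real l'" "u' * q + t' = complex_of_real l'"
    unfolding rigid_motion_def by auto
  have "u * (q - p) = (u * q + t) - (u * p + t)" "u' * (q - p) = (u' * q + t') - (u' * p + t')"
    by (simp_all add: algebra_simps)
  then have 1: "u * (q - p) = of_real (2 * l)" "u' * (q - p) = of_real (2 * l')"
    unfolding * by simp_all
  have "cmod (q - p) = 2 * l" "cmod (q - p) = 2 * l'"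
    using arg_cong[OF 1(1), of cmod] arg_cong[OF 1(2), of cmod] * by (auto simp: norm_mult)
  then have l: "l = l'" by simp
  with 1 have "u * (q - p) = u' * (q - p)" by simp
  with assms have u: "u = u'" by simp
  with * l have "t = t'" by (metis add_left_cancel)
  with u * show "T = T'" by simp
qed

lemma diag_frame_props:
  assumes "p \<noteq> q"
  shows "rigid_motion (diag_frame p q)"
    "diag_frame p q p = - complex_of_real (diag_l p q)"
    "diag_frame p q q = complex_of_real (diag_l p q)" "0 < diag_l p q"
  using theI'[OF diag_frame_unique[OF assms]] unfolding diag_frame_def[symmetric] diag_l_def
  by auto

lemma diag_frame_swap:
  assumes "p \<noteq> q"
  shows "diag_frame q p = (\<lambda>z. - diag_frame p q z)"
  unfolding diag_frame_def[of q p]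
proof (rule the1_equality[OF diag_frame_unique])
  show "q \<noteq> p" using assms by simp
  obtain u t where "cmod u = 1" "diag_frame p q = (\<lambda>z. u * z + t)"
    using diag_frame_props(1)[OF assms] unfolding rigid_motion_def by blast
  then have "rigid_motion (\<lambda>z. - diag_frame p q z)"
    unfolding rigid_motion_def by (intro exI[of _ "- u"] exI[of _ "- t"]) auto
  then show "rigid_motion (\<lambda>z. - diag_frame p q z) \<and>
     (\<exists>l::real. 0 < l \<and> - diag_frame p q q = - complex_of_real l
        \<and> - diag_frame p q p = complex_of_real l)"
    using diag_frame_props[OF assms] by auto
qed

lemma diag_l_swap: "p \<noteq> q \<Longrightarrow> diag_l q p = diag_l p q"
  using diag_frame_swap[of p q] diag_frame_props(2)[of p q] by (simp add: diag_l_def)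

lemma d_swap:
  assumes "v a \<noteq> v b"
  shows "d_a n v b a = d_b n v a b" "d_b n v b a = d_a n v a b"
proof -
  have *: "((- x) * (- y') - (- x') * (- y)) / (- z - - z') * c = (x' * y - x * y') / (z - z') * c"
    for x y x' y' z z' c :: real
  proof -
    have "(- x) * (- y') - (- x') * (- y) = - (x' * y - x * y')" "- z - - z' = - (z - z')"
      by simp_all
    then show ?thesis by (simp only: minus_divide_divide)
  qed
  show "d_a n v b a = d_b n v a b" "d_b n v b a = d_a n v a b"
    unfolding d_a_def d_b_def Let_def diag_l_swap[OF assms] diag_frame_swap[OF assms] o_def
      uminus_complex.sel by (rule *)+
qed

lemma edge_coeffs_uminus: "edge_coeffs s d (- p) (- m) (- q) = edge_coeffs s d p m q"
proof -
  have "x *\<^sub>R (- p) + y *\<^sub>R (- q) = z *\<^sub>R (- m) \<longleftrightarrow> x *\<^sub>R p + y *\<^sub>R q = z *\<^sub>R m" for x y z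
    by (metis add.inverse_inverse minus_add_distrib scaleR_minus_right)
  then show ?thesis unfolding edge_coeffs_def by simp
qed

lemma nxt_prv: "i < n \<Longrightarrow> nxt n (prv n i) = i"
  by (cases i) (auto simp: nxt_def prv_def mod_Suc)

lemma prv_nxt: "i < n \<Longrightarrow> prv n (nxt n i) = i"
  by (auto simp: nxt_def prv_def mod_Suc)

lemma prv_less: "i < n \<Longrightarrow> prv n i < n"
  by (simp add: prv_def)

lemma diag_coeff_swap:
  assumes "{a, b} \<in> D_set n" "a < n" "b < n" "v a \<noteq> v b"
  shows "diag_coeff n v b a ij = diag_coeff n v a b ij"
proof -
  have "a \<noteq> b" using assms by (auto simp: D_set_def V_set_def)
  have E: "{a, b} \<notin> E_set n" using assms by (auto simp: D_set_def)
  have n: "nxt n a \<noteq> b" "nxt n b \<noteq> a"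
    using E assms(2,3) unfolding E_set_def by (auto simp: insert_commute)
  have p: "prv n a \<noteq> b" "prv n b \<noteq> a"
    using n nxt_prv[of a n] nxt_prv[of b n] assms by auto
  have s: "diag_s n v b a = diag_s n v a b"
    by (simp add: diag_s_def d_swap[OF assms(4)] add.commute)
  have distinct: "{prv n a, a} \<noteq> {prv n b, b}" "{prv n a, a} \<noteq> {b, nxt n b}"
    "{a, nxt n a} \<noteq> {prv n b, b}" "{a, nxt n a} \<noteq> {b, nxt n b}"
    "{a, a} \<noteq> {prv n b, b}" "{a, a} \<noteq> {b, nxt n b}"
    "{b, b} \<noteq> {prv n a, a}" "{b, b} \<noteq> {a, nxt n a}" "{a, a} \<noteq> {b, b}"
    using n p \<open>a \<noteq> b\<close> by (auto simp only: doubleton_eq_iff)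
  have reorder: "(if P1 then x1 else if P2 then x2 else if Q1 then y1 else if Q2 then y2
        else if P3 then x3 else if Q3 then y3 else 0) =
      (if Q1 then y1 else if Q2 then y2 else if P1 then x1 else if P2 then x2
        else if Q3 then y3 else if P3 then x3 else (0::real))"
    if "\<not> (P1 \<and> Q1)" "\<not> (P1 \<and> Q2)" "\<not> (P2 \<and> Q1)" "\<not> (P2 \<and> Q2)" "\<not> (P3 \<and> Q3)"
    for P1 P2 P3 Q1 Q2 Q3 x1 x2 x3 y1 y2 y3
    using that by presburger
  show ?thesis
    unfolding diag_coeff_def Let_def d_swap[OF assms(4)] s diag_frame_swap[OF assms(4)] o_def
      edge_coeffs_uminus add.commute[of "d_b n v a b" "d_a n v a b"]
    by (rule reorder) (use distinct in metis)+
qed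

end

theory Submission
  imports Defs
begin

text \<open>
  Two facts give the bound. First, a polygon of diameter one whose vertices are more than
  \<open>ds\<close> apart has a bounded number n of vertices, by total boundedness of the disc
  (\<open>separated_points_bounded_number\<close>), so that a row has boundedly many entries. It remains to
  bound each entry by a constant, which is only an issue in the column of a diagonal ab.

  There every denominator is 2 - (d_a + d_b) = (1 - d_a) + (1 - d_b). Let e and f be the edge
  vectors from the vertex a to its two neighbours, and let C be the cross product of e and f. Since
  the point with abscissa - d_a l is where the line through the neighbours of a meets the line ab,
  (1 - d_a) l is the distance from a to that line, measured along the diagonal; in formulas,
  (1 - d_a) l h = C, where h is the difference of the heights of the two neighbours over the diagonal.
  As h and l are at most 1, this gives 1 - d_a \<ge> C. The same point is also a convex
  combination of the neighbours, hence (1 - d_a) l \<le> 1, and l > \<open>ds\<close> / 2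
  (\<open>one_minus_d_a_bounds\<close>). The coefficients of the four edges next to a and b are s times
  convex weights of those combinations, so they lie between 0 and s (\<open>edge_coeffs_bounded\<close>).

  Everything is thus reduced to a positive lower bound for C, uniform over all polygons in question
  (\<open>corner_ge_corner_bound\<close>). If the interior angle at a is obtuse, then C = |e| |f| sin \<beta> with
  \<beta> between pi/2 and \<open>\<beta>s\<close>, and G2 and G3 bound it below. If it is not obtuse, the
  danger is that the corner is very thin. But G1 and diameter one give a disc of radius
  1 / \<open>\<gamma>s\<close> in the polygon, which lies in the sector spanned by e and f; a disc in a thin
  sector has to be far away from the apex, and here its centre is at distance at most one
  (\<open>cross_ge_inscribed_disc\<close>).
\<close>

section \<open>Plane geometry\<close>

abbreviation cross :: "complex \<Rightarrow> complex \<Rightarrow> real" where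
  "cross p q \<equiv> Im (cnj p * q)"

lemma cross_rotate:
  assumes "cmod u = 1"
  shows "cross (u * p) (u * q) = cross p q"
proof -
  have 1: "cnj (u * p) * (u * q) = (u * cnj u) * (cnj p * q)" by (simp add: mult_ac)
  have 2: "u * cnj u = 1" using assms complex_norm_square[of u] by simp
  show ?thesis unfolding 1 2 by simp
qed

text \<open>Cover the disc by finitely many balls of radius \<open>\<epsilon> / 2\<close>: each of them contains at most
  one of the points.\<close>

lemma separated_points_bounded_number:
  assumes "0 < (\<epsilon>::real)"
  shows "\<exists>N. \<forall>n (w :: nat \<Rightarrow> complex). (\<forall>i<n. cmod (w i - w 0) \<le> r) \<longrightarrow>
           (\<forall>i<n. \<forall>j<n. i \<noteq> j \<longrightarrow> \<epsilon> < cmod (w i - w j)) \<longrightarrow> (n::nat) \<le> N"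
proof -
  have "\<exists>k. finite k \<and> k \<subseteq> cball (0::complex) r \<and> cball 0 r \<subseteq> (\<Union>x\<in>k. ball x (\<epsilon>/2))"
    using seq_compact_imp_totally_bounded[of "cball (0::complex) r"] assms
    by (simp add: compact_imp_seq_compact)
  then obtain k where k: "finite k" "cball (0::complex) r \<subseteq> (\<Union>x\<in>k. ball x (\<epsilon>/2))"
    by blast
  have "n \<le> card k"
    if near: "\<forall>i<n. cmod (w i - w 0) \<le> r"
      and sep: "\<forall>i<n. \<forall>j<n. i \<noteq> j \<longrightarrow> \<epsilon> < cmod (w i - w j)" for n w
  proof -
    have "\<exists>x\<in>k. dist x (w i - w 0) < \<epsilon>/2" if "i < n" for i
    proof -
      have "w i - w 0 \<in> cball 0 r" using near that by simp
      then show ?thesis using k(2) by (meson UN_E mem_ball subsetD)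
    qed
    then obtain g where g: "\<And>i. i < n \<Longrightarrow> g i \<in> k" "\<And>i. i < n \<Longrightarrow> dist (g i) (w i - w 0) < \<epsilon>/2"
      by metis
    have "inj_on g {..<n}"
    proof (rule inj_onI, rule ccontr)
      fix i j assume ij: "i \<in> {..<n}" "j \<in> {..<n}" "g i = g j" "i \<noteq> j"
      then have "dist (g i) (w i - w 0) < \<epsilon>/2" "dist (g i) (w j - w 0) < \<epsilon>/2"
        using g(2)[of i] g(2)[of j] by auto
      then have "dist (w i - w 0) (w j - w 0) < \<epsilon>" by (rule dist_triangle_half_r)
      then show False using sep ij by (fastforce simp: dist_norm)
    qed
    then have "card {..<n} \<le> card k" using g(1) k(1) by (intro card_inj_on_le[of g]) auto
    then show ?thesis by simp
  qed
  then show ?thesis by blast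
qed

text \<open>The centre of a disc inside the sector with apex c spanned by e and f has distance at least r
  from both sides. Its inner product with e, relative to c, is at most 1, but in terms of these two
  distances this product has \<open>cross e f\<close> in the denominator, so \<open>cross e f\<close> cannot be
  small. That the angle is not obtuse makes both contributions to the product nonnegative.\<close>

lemma cross_ge_inscribed_disc:
  assumes disc: "cball x r \<subseteq> {z. 0 \<le> cross e (z - c) \<and> 0 \<le> cross (z - c) f}"
    and "0 \<le> r" "0 < d" "d \<le> cmod e" "cmod e \<le> 1" "d \<le> cmod f" "cmod (x - c) \<le> 1"
    and acute: "0 \<le> Re (cnj e * f)" and "0 \<le> cross e f"
  shows "r * d ^ 3 \<le> cross e f"
proof -
  define y where "y = x - c"
  have "0 < cmod e" "0 < cmod f" using assms by linarith+
  then have ef: "e \<noteq> 0" "f \<noteq> 0" by auto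
  have sq: "cnj z * z = of_real (cmod z) ^ 2" for z
    using complex_norm_square[of z] by (simp add: mult.commute)
  have e: "r * cmod e \<le> cross e y"
  proof -
    \<comment> \<open>the point of the disc that is closest to the line spanned by e\<close>
    define z where "z = x - \<i> * of_real r * sgn e"
    have "cmod (x - z) = r" using ef \<open>0 \<le> r\<close> by (simp add: z_def norm_mult norm_sgn)
    then have "0 \<le> cross e (z - c)" using disc by (auto simp: dist_norm)
    also have "cnj e * (z - c) = cnj e * y - \<i> * of_real r * (cnj e * e / of_real (cmod e))"
      by (simp add: z_def y_def sgn_eq algebra_simps)
    also have "cnj e * e / of_real (cmod e) = of_real (cmod e)"
      using ef unfolding sq by (simp add: power2_eq_square)
    finally show ?thesis by simp
  qed
  have f: "r * cmod f \<le> cross y f"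
  proof -
    define z where "z = x + \<i> * of_real r * sgn f"
    have "cmod (x - z) = r" using ef \<open>0 \<le> r\<close> by (simp add: z_def norm_mult norm_sgn)
    then have "0 \<le> cross (z - c) f" using disc by (auto simp: dist_norm)
    also have "cnj (z - c) * f = cnj y * f - \<i> * of_real r * (cnj f * f / of_real (cmod f))"
      by (simp add: z_def y_def sgn_eq algebra_simps)
    also have "cnj f * f / of_real (cmod f) = of_real (cmod f)"
      using ef unfolding sq by (simp add: power2_eq_square)
    finally show ?thesis by simp
  qed
  have "0 \<le> cross e y" using e \<open>0 \<le> r\<close> by (smt (verit) mult_nonneg_nonneg norm_ge_zero)
  \<comment> \<open>Cramer's rule: \<open>cross e f\<close> times y is \<open>cross y f\<close> times e plus \<open>cross e y\<close> times f; pair it with e.\<close>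
  have cramer: "cross e f * Re (cnj e * y) = cross y f * (cmod e)\<^sup>2 + cross e y * Re (cnj e * f)"
    unfolding cmod_power2 by (simp add: algebra_simps power2_eq_square)
  have "r * d * d\<^sup>2 \<le> cross y f * (cmod e)\<^sup>2"
  proof (rule mult_mono)
    have "r * d \<le> r * cmod f" using assms by (intro mult_left_mono) auto
    then show rd: "r * d \<le> cross y f" using f by linarith
    have "0 \<le> r * d" using assms by simp
    with rd show "0 \<le> cross y f" by linarith
  qed (use assms in \<open>auto intro: power_mono\<close>)
  also have "\<dots> \<le> cross e f * Re (cnj e * y)"
    using cramer \<open>0 \<le> cross e y\<close> acute by (simp del: times_complex.sel)
  finally have main: "r * d ^ 3 \<le> cross e f * Re (cnj e * y)"
    by (simp add: power3_eq_cube power2_eq_square mult_ac)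
  have re: "\<bar>Re (cnj e * y)\<bar> \<le> 1"
  proof -
    have "\<bar>Re (cnj e * y)\<bar> \<le> cmod (cnj e * y)" by (rule abs_Re_le_cmod)
    also have "\<dots> = cmod e * cmod y" by (simp add: norm_mult)
    also have "\<dots> \<le> 1 * 1" using assms by (intro mult_mono) (auto simp: y_def)
    finally show ?thesis by simp
  qed
  have "cross e f * Re (cnj e * y) \<le> cross e f * 1"
    using re \<open>0 \<le> cross e f\<close> by (intro mult_left_mono) auto
  with main show ?thesis by simp
qed

lemma cross_eq_sin_Arg2pi:
  assumes "e \<noteq> 0"
  shows "cross e f = cmod e * cmod f * sin (Arg2pi (f / e))"
    and "Re (cnj e * f) = cmod e * cmod f * cos (Arg2pi (f / e))"
proof -
  have "cnj e * f = of_real ((cmod e)\<^sup>2) * (f / e)"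
    using assms complex_norm_square[of e] by simp
  also have "f / e = of_real (cmod f / cmod e) * cis (Arg2pi (f / e))"
    using Arg2pi_eq[of "f / e"] by (simp add: norm_divide cis_conv_exp)
  finally have "cnj e * f = of_real (cmod e * cmod f) * cis (Arg2pi (f / e))"
    using assms by (simp add: power2_eq_square)
  moreover have "Im (of_real r * cis t) = r * sin t" "Re (of_real r * cis t) = r * cos t"
    for r t by simp_all
  ultimately show "cross e f = cmod e * cmod f * sin (Arg2pi (f / e))"
    "Re (cnj e * f) = cmod e * cmod f * cos (Arg2pi (f / e))" by (simp_all only:)
qed

text \<open>The maximum with pi/2 makes the sine positive for every \<open>\<beta> < pi\<close>, also for
  nonpositive \<open>\<beta>\<close>, and changes nothing when an obtuse angle below \<open>\<beta>\<close> exists.\<close>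

lemma cross_ge_obtuse:
  assumes "0 < cross e f" "Re (cnj e * f) < 0"
    and "Arg2pi (f / e) < \<beta>" "\<beta> < pi"
    and "0 < d" "d \<le> cmod e" "d \<le> cmod f"
  shows "d\<^sup>2 * sin (max \<beta> (pi / 2)) \<le> cross e f"
proof -
  have "e \<noteq> 0" "f \<noteq> 0" using assms by auto
  define \<theta> where "\<theta> = Arg2pi (f / e)"
  have eq: "cross e f = cmod e * cmod f * sin \<theta>" "Re (cnj e * f) = cmod e * cmod f * cos \<theta>"
    unfolding \<theta>_def by (rule cross_eq_sin_Arg2pi[OF \<open>e \<noteq> 0\<close>])+
  have pos: "0 < cmod e * cmod f" using \<open>e \<noteq> 0\<close> \<open>f \<noteq> 0\<close> by simp
  have "0 \<le> \<theta>" unfolding \<theta>_def by (rule Arg2pi_ge_0)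
  have "cos \<theta> < 0" using pos assms(2) unfolding eq by (simp add: mult_less_0_iff)
  then have "pi / 2 < \<theta>" using \<open>0 \<le> \<theta>\<close> cos_ge_zero[of \<theta>] by linarith
  have "\<theta> < \<beta>" using assms(3) by (simp add: \<theta>_def)
  then have max: "max \<beta> (pi / 2) = \<beta>" using \<open>pi / 2 < \<theta>\<close> by simp
  have "sin (pi - \<beta>) \<le> sin (pi - \<theta>)"
    using \<open>\<theta> < \<beta>\<close> \<open>pi / 2 < \<theta>\<close> assms(4) by (intro sin_monotone_2pi_le) auto
  then have sin: "sin \<beta> \<le> sin \<theta>" by simp
  have "0 \<le> sin \<beta>" using \<open>0 \<le> \<theta>\<close> \<open>\<theta> < \<beta>\<close> assms(4) by (intro sin_ge_zero) auto
  have "d * d * sin \<beta> \<le> cmod e * cmod f * sin \<theta>"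
    using assms sin \<open>0 \<le> sin \<beta>\<close> by (intro mult_mono) auto
  then show ?thesis unfolding max eq by (simp add: power2_eq_square)
qed

section \<open>Corners of a convex polygon\<close>

lemma nxt_less: "a < n \<Longrightarrow> nxt n a < n"
  by (simp add: nxt_def)

lemma cyclic_neighbours_distinct:
  assumes "3 \<le> n" "a < n"
  shows "nxt n a \<noteq> a" "prv n a \<noteq> a" "prv n a \<noteq> nxt n a"
proof -
  have "nxt n a = (if a + 1 = n then 0 else a + 1)"
    using assms by (simp add: nxt_def)
  moreover have "prv n a = (if a = 0 then n - 1 else a - 1)"
  proof (cases a)
    case (Suc k)
    then have "a + n - 1 = k + n" "k < n" using assms by auto
    then show ?thesis using Suc by (simp add: prv_def)
  qed (use assms in \<open>auto simp: prv_def\<close>)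
  ultimately show "nxt n a \<noteq> a" "prv n a \<noteq> a" "prv n a \<noteq> nxt n a"
    using assms by (auto split: if_splits)
qed

definition corner :: "nat \<Rightarrow> (nat \<Rightarrow> complex) \<Rightarrow> nat \<Rightarrow> real" where
  "corner n v a = cross (v (nxt n a) - v a) (v (prv n a) - v a)"

lemma cross_outgoing_pos:
  assumes "convex_polygon_ccw n v" "a < n" "j < n" "j \<noteq> a" "j \<noteq> nxt n a"
  shows "0 < cross (v (nxt n a) - v a) (v j - v a)"
  using assms unfolding convex_polygon_ccw_def by blast

text \<open>The condition on the edge that ends at a, moved from its starting point to a.\<close>

lemma cross_incoming_pos:
  assumes "convex_polygon_ccw n v" "a < n" "j < n" "j \<noteq> a" "j \<noteq> prv n a"
  shows "0 < cross (v j - v a) (v (prv n a) - v a)"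
proof -
  have "0 < cross (v a - v (prv n a)) (v j - v (prv n a))"
    using cross_outgoing_pos[of n v "prv n a" j] assms by (simp add: nxt_prv prv_less)
  then show ?thesis by (simp add: algebra_simps)
qed

lemma corner_pos:
  assumes "convex_polygon_ccw n v" "a < n"
  shows "0 < corner n v a"
proof -
  have "3 \<le> n" using assms by (simp add: convex_polygon_ccw_def)
  then show ?thesis
    unfolding corner_def using assms cyclic_neighbours_distinct[of n a]
    by (intro cross_outgoing_pos) (auto simp: prv_less)
qed

lemma convex_cross_half_plane:
  "convex {z. 0 \<le> cross e (z - c)}" "convex {z. 0 \<le> cross (z - c) f}"
proof -
  have "{z. 0 \<le> cross e (z - c)} = {z. inner (\<i> * e) c \<le> inner (\<i> * e) z}"
    "{z. 0 \<le> cross (z - c) f} = {z. inner (\<i> * f) z \<le> inner (\<i> * f) c}"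
    by (auto simp: inner_complex_def algebra_simps)
  then show "convex {z. 0 \<le> cross e (z - c)}" "convex {z. 0 \<le> cross (z - c) f}"
    by (simp_all only: convex_halfspace_le convex_halfspace_ge)
qed

lemma polygon_subset_corner_sector:
  assumes "convex_polygon_ccw n v" "a < n"
  shows "polygon n v \<subseteq> {z. 0 \<le> cross (v (nxt n a) - v a) (z - v a) \<and>
           0 \<le> cross (z - v a) (v (prv n a) - v a)}"
proof -
  have out: "0 \<le> cross (v (nxt n a) - v a) (v j - v a)" if "j < n" for j
    using cross_outgoing_pos[OF assms that]
    by (cases "j = a \<or> j = nxt n a") (auto simp: algebra_simps)
  have "0 \<le> cross (v j - v a) (v (prv n a) - v a)" if "j < n" for j
    using cross_incoming_pos[OF assms that]
    by (cases "j = a \<or> j = prv n a") (auto simp: algebra_simps)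
  with out show ?thesis
    unfolding polygon_def Collect_conj_eq
    by (intro hull_minimal convex_Int convex_cross_half_plane) auto
qed

lemma bounded_polygon: "bounded (polygon n v)"
  unfolding polygon_def by (intro bounded_convex_hull finite_imp_bounded) simp

lemma vertex_in_polygon: "i < n \<Longrightarrow> v i \<in> polygon n v"
  unfolding polygon_def by (intro hull_inc) simp

lemma dist_polygon_le_diameter:
  assumes "x \<in> polygon n v" "y \<in> polygon n v"
  shows "cmod (x - y) \<le> diameter (polygon n v)"
  using diameter_bounded_bound[OF bounded_polygon assms] by (simp add: dist_norm)

text \<open>The aspect ratio alone does not exclude inradius 0, because division by zero yields 0. The
  triangle on three consecutive vertices is not degenerate and provides a disc.\<close>

lemma inradius_pos:
  assumes "convex_polygon_ccw n v"
  shows "0 < inradius (polygon n v)"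
proof -
  define R where "R = {r. 0 \<le> r \<and> (\<exists>x. cball x r \<subseteq> polygon n v)}"
  have n: "3 \<le> n" using assms by (simp add: convex_polygon_ccw_def)
  have cross: "0 < cross (v 1 - v 0) (v 2 - v 0)"
    using cross_outgoing_pos[OF assms, of 0 2] n by (simp add: nxt_def)
  have "\<not> collinear {v 1, v 0, v 2}"
  proof
    assume "collinear {v 1, v 0, v 2}"
    then have "collinear {0, v 1 - v 0, v 2 - v 0}" by (subst (asm) collinear_3) auto
    then have "v 1 - v 0 = 0 \<or> v 2 - v 0 = 0 \<or> (\<exists>c. v 2 - v 0 = c *\<^sub>R (v 1 - v 0))"
      by (subst (asm) collinear_lemma)
    then have "cross (v 1 - v 0) (v 2 - v 0) = 0"
      by (elim disjE exE) (simp_all del: minus_complex.sel complex_cnj_diff)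
    with cross show False by simp
  qed
  then have *: "v 1 \<noteq> v 0" "v 1 \<noteq> v 2" "v 0 \<noteq> v 2" "\<not> affine_dependent {v 1, v 0, v 2}"
    by (auto simp: collinear_3_eq_affine_dependent)
  then have "card {v 1, v 0, v 2} = Suc DIM(complex)" by simp
  with *(4) have "interior (convex hull {v 1, v 0, v 2}) \<noteq> {}"
    by (simp add: interior_convex_hull_eq_empty)
  moreover have "convex hull {v 1, v 0, v 2} \<subseteq> polygon n v"
    unfolding polygon_def by (rule hull_mono) (use n in auto)
  ultimately obtain x where "x \<in> interior (polygon n v)"
    using interior_mono by blast
  then obtain r where r: "0 < r" "cball x r \<subseteq> polygon n v"
    unfolding mem_interior_cball by blast
  have "bdd_above R"
  proof (rule bdd_aboveI)
    fix r assume "r \<in> R"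
    then obtain x where "0 \<le> r" "cball x r \<subseteq> polygon n v" by (auto simp: R_def)
    then show "r \<le> diameter (polygon n v) / 2"
      using diameter_subset[OF _ bounded_polygon, of "cball x r" n v] by simp
  qed
  moreover have "r \<in> R" using r by (auto simp: R_def)
  ultimately have "r \<le> Sup R" by (rule cSup_upper[rotated])
  with r show ?thesis by (simp add: inradius_def R_def)
qed

lemma inscribed_disc_of_aspect_ratio:
  assumes "convex_polygon_ccw n v" "diameter (polygon n v) = 1"
    "aspect_ratio (polygon n v) < \<gamma>"
  shows "\<exists>x. cball x (1 / \<gamma>) \<subseteq> polygon n v"
proof -
  define R where "R = {r. 0 \<le> r \<and> (\<exists>x. cball x r \<subseteq> polygon n v)}"
  have pos: "0 < inradius (polygon n v)" by (rule inradius_pos) fact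
  have lt: "1 / inradius (polygon n v) < \<gamma>" using assms by (simp add: aspect_ratio_def)
  have "0 < 1 / inradius (polygon n v)" using pos by simp
  with lt have "0 < \<gamma>" by linarith
  then have "1 / \<gamma> < Sup R"
    using lt pos by (simp add: inradius_def R_def field_simps)
  moreover have "R \<noteq> {}"
    using inradius_pos[OF assms(1)] vertex_in_polygon[of 0 n v] assms(1)
    by (auto simp: R_def convex_polygon_ccw_def intro!: exI[of _ 0] exI[of _ "v 0"])
  ultimately obtain r where "r \<in> R" "1 / \<gamma> < r" using less_cSupD[of R "1 / \<gamma>"] by blast
  then obtain x where "1 / \<gamma> \<le> r" "cball x r \<subseteq> polygon n v" by (auto simp: R_def)
  then show ?thesis by (meson subset_cball subset_trans)
qed

text \<open>The two terms belong to the non-obtuse and to the obtuse corners.\<close>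

definition corner_bound :: "real \<Rightarrow> real \<Rightarrow> real \<Rightarrow> real" where
  "corner_bound \<gamma> d \<beta> = min (1 / \<gamma> * d ^ 3) (d\<^sup>2 * sin (max \<beta> (pi / 2)))"

lemma corner_bound_pos:
  assumes "0 < \<gamma>" "0 < d" "\<beta> < pi"
  shows "0 < corner_bound \<gamma> d \<beta>"
proof -
  have "0 < sin (max \<beta> (pi / 2))"
    using assms by (intro sin_gt_zero) (auto simp: less_max_iff_disj)
  then show ?thesis using assms by (simp add: corner_bound_def)
qed

lemma corner_ge_corner_bound:
  assumes conv: "convex_polygon_ccw n v" and diam: "diameter (polygon n v) = 1"
    and aspect: "aspect_ratio (polygon n v) < \<gamma>" "0 < \<gamma>"
    and sep: "\<forall>i<n. \<forall>j<n. i \<noteq> j \<longrightarrow> d < cmod (v i - v j)" "0 < d"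
    and angle: "interior_angle n v a < \<beta>" "\<beta> < pi" and "a < n"
  shows "corner_bound \<gamma> d \<beta> \<le> corner n v a"
proof -
  define e f where "e = v (nxt n a) - v a" and "f = v (prv n a) - v a"
  have n: "3 \<le> n" using conv by (simp add: convex_polygon_ccw_def)
  note distinct = cyclic_neighbours_distinct[OF n \<open>a < n\<close>]
  have len: "d \<le> cmod e" "d \<le> cmod f"
    using sep(1) \<open>a < n\<close> distinct nxt_less[of a n] prv_less[of a n]
    unfolding e_def f_def by (meson less_imp_le)+
  have "cmod e \<le> 1"
    unfolding e_def diam[symmetric] using \<open>a < n\<close>
    by (intro dist_polygon_le_diameter vertex_in_polygon nxt_less)
  have pos: "0 < cross e f"
    using corner_pos[OF conv \<open>a < n\<close>] by (simp only: corner_def e_def f_def)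
  show ?thesis
  proof (cases "0 \<le> Re (cnj e * f)")
    case True
    obtain x where x: "cball x (1 / \<gamma>) \<subseteq> polygon n v"
      using inscribed_disc_of_aspect_ratio[OF conv diam aspect(1)] by blast
    have "cmod (x - v a) \<le> 1"
      unfolding diam[symmetric] using \<open>a < n\<close> x aspect(2)
      by (intro dist_polygon_le_diameter vertex_in_polygon) auto
    moreover have "cball x (1 / \<gamma>) \<subseteq> {z. 0 \<le> cross e (z - v a) \<and> 0 \<le> cross (z - v a) f}"
      using x polygon_subset_corner_sector[OF conv \<open>a < n\<close>] unfolding e_def f_def by blast
    ultimately have "1 / \<gamma> * d ^ 3 \<le> cross e f"
      using len \<open>cmod e \<le> 1\<close> sep(2) aspect(2) True pos
      by (intro cross_ge_inscribed_disc[where x = x and c = "v a"]) auto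
    then show ?thesis by (simp add: corner_bound_def corner_def e_def f_def min.coboundedI1)
  next
    case False
    then have "d\<^sup>2 * sin (max \<beta> (pi / 2)) \<le> cross e f"
      using pos angle len sep(2)
      by (intro cross_ge_obtuse) (simp_all only: interior_angle_def e_def f_def not_le)
    then show ?thesis by (simp add: corner_bound_def corner_def e_def f_def min.coboundedI2)
  qed
qed

section \<open>Columns of diagonals\<close>

text \<open>When p lies above and q below the horizontal axis, the segment from p to q meets the axis in
  a convex combination of p and q. The hypothesis on the intercept says that this point is d m, so the
  coefficients are the weights of this combination, scaled by s.\<close>

lemma edge_coeffs_bounded:
  assumes "0 \<le> s" "Im m = 0" "Im q < 0" "0 < Im p"
    and intercept: "Re q * Im p - Re p * Im q = d * Re m * (Im p - Im q)"
  shows "\<bar>fst (edge_coeffs s d p m q)\<bar> \<le> s" "\<bar>snd (edge_coeffs s d p m q)\<bar> \<le> s"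
proof -
  define h where "h = Im p - Im q"
  have h: "0 < h" using assms by (simp add: h_def)
  define c where "c = (s * (- Im q) / h, s * Im p / h)"
  have "edge_coeffs s d p m q = c"
    unfolding edge_coeffs_def
  proof (rule the_equality)
    have "fst c + snd c = s"
      using h by (simp add: c_def field_simps) (simp add: h_def algebra_simps)
    moreover have "fst c * Im p + snd c * Im q = 0" by (simp add: c_def)
    moreover have "fst c * Re p + snd c * Re q = s * (Re q * Im p - Re p * Im q) / h"
      by (simp add: c_def algebra_simps add_divide_distrib diff_divide_distrib)
    then have "fst c * Re p + snd c * Re q = s * d * Re m"
      using h unfolding intercept h_def[symmetric] by simp
    ultimately show "fst c + snd c = s \<and> fst c *\<^sub>R p + snd c *\<^sub>R q = (s * d) *\<^sub>R m"
      using \<open>Im m = 0\<close> by (simp add: complex_eq_iff)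
  next
    fix k assume k: "fst k + snd k = s \<and> fst k *\<^sub>R p + snd k *\<^sub>R q = (s * d) *\<^sub>R m"
    then have "Im (fst k *\<^sub>R p + snd k *\<^sub>R q) = Im ((s * d) *\<^sub>R m)" by simp
    then have im: "fst k * Im p + snd k * Im q = 0" using \<open>Im m = 0\<close> by simp
    have s: "snd k = s - fst k" using k by simp
    have "fst k * h = s * (- Im q)" "snd k * h = s * Im p"
      using im unfolding s h_def by (simp_all add: algebra_simps)
    then show "k = c" using h by (simp add: c_def prod_eq_iff field_simps)
  qed
  moreover have "s * (- Im q) \<le> s * h" "s * Im p \<le> s * h"
    using assms by (intro mult_left_mono; simp add: h_def)+
  ultimately show "\<bar>fst (edge_coeffs s d p m q)\<bar> \<le> s" "\<bar>snd (edge_coeffs s d p m q)\<bar> \<le> s"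
    using assms h by (simp_all add: c_def abs_mult field_simps)
qed

lemma diagonal_neighbours:
  assumes "{a, b} \<in> D_set n" "a < n" "b < n"
  shows "a \<noteq> b" "b \<noteq> nxt n a" "b \<noteq> prv n a"
proof -
  have E: "{a, b} \<notin> E_set n" using assms by (auto simp: D_set_def)
  show "a \<noteq> b" using assms by (auto simp: D_set_def V_set_def)
  show "b \<noteq> nxt n a" using E assms(2) unfolding E_set_def by auto
  show "b \<noteq> prv n a"
  proof
    assume "b = prv n a"
    then have "{a, b} = {b, nxt n b}" using nxt_prv[OF assms(2)] by auto
    then show False using E assms(3) unfolding E_set_def by auto
  qed
qed

lemma diagonal_vertices_distinct:
  assumes "convex_polygon_ccw n v" "{a, b} \<in> D_set n" "a < n" "b < n"
  shows "v a \<noteq> v b"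
  using cross_outgoing_pos[OF assms(1,3,4)] diagonal_neighbours[OF assms(2-4)] by auto

text \<open>Cross products are invariant under rigid motions, so convexity at the vertex a puts the
  predecessor of a above the diagonal and the successor below it. The last two equations express that
  the line through the neighbours of a meets the horizontal axis at abscissa \<open>- d_a l\<close>, that is,
  at distance \<open>(1 - d_a) l\<close> from a. Only the vertex a is treated; exchanging a and
  b turns \<open>d_a\<close> into \<open>d_b\<close>.\<close>

lemma diagonal_frame:
  assumes "convex_polygon_ccw n v" "{a, b} \<in> D_set n" "a < n" "b < n"
  defines "T \<equiv> diag_frame (v a) (v b)" and "l \<equiv> diag_l (v a) (v b)"
  defines "p \<equiv> T (v (prv n a))" and "q \<equiv> T (v (nxt n a))"
  shows "T (v a) = - of_real l" "0 < l" "2 * l = cmod (v b - v a)"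
    and "cmod (T x - T y) = cmod (x - y)"
    and "0 < Im p" "Im q < 0"
    and "(1 - d_a n v a b) * (l * (Im p - Im q)) = corner n v a"
    and "Re q * Im p - Re p * Im q = d_a n v a b * - l * (Im p - Im q)"
proof -
  have ne: "v a \<noteq> v b" using assms by (intro diagonal_vertices_distinct)
  obtain u t where u: "cmod u = 1" and T: "T = (\<lambda>z. u * z + t)"
    using diag_frame_props(1)[OF ne] unfolding T_def rigid_motion_def by blast
  have diff: "T y - T x = u * (y - x)" for x y by (simp add: T algebra_simps)
  then show iso: "cmod (T x - T y) = cmod (x - y)" for x y by (simp add: norm_mult u)
  have cr: "cross (T y - T x) (T z - T x) = cross (y - x) (z - x)" for x y z
    unfolding diff by (rule cross_rotate[OF u])
  show Ta: "T (v a) = - of_real l" and l: "0 < l"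
    using diag_frame_props[OF ne] by (simp_all add: T_def l_def)
  have Tb: "T (v b) = of_real l" using diag_frame_props[OF ne] by (simp add: T_def l_def)
  have "T (v b) - T (v a) = of_real (2 * l)" by (simp add: Ta Tb)
  then show "2 * l = cmod (v b - v a)" using l iso[of "v b" "v a"] by simp
  note nb = diagonal_neighbours[OF assms(2-4)]
  have "0 < cross (q - T (v a)) (T (v b) - T (v a))"
    unfolding q_def cr by (rule cross_outgoing_pos) (use assms nb in auto)
  then show q: "Im q < 0" using l by (simp add: Ta Tb mult_less_0_iff)
  have "0 < cross (T (v b) - T (v a)) (p - T (v a))"
    unfolding p_def cr by (rule cross_incoming_pos) (use assms nb in auto)
  then show p: "0 < Im p" using l by (simp add: Ta Tb zero_less_mult_iff)
  have "corner n v a = cross (q - T (v a)) (p - T (v a))"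
    unfolding corner_def p_def q_def cr ..
  then have c: "corner n v a = (Re q + l) * Im p - Im q * (Re p + l)" by (simp add: Ta)
  have "d_a n v a b = (Re p * Im q - Re q * Im p) / (Im p - Im q) * (1 / l)"
    by (simp add: d_a_def p_def q_def T_def l_def Let_def)
  then have "d_a n v a b * (l * (Im p - Im q)) = Re p * Im q - Re q * Im p"
    using p q l by simp
  then show "(1 - d_a n v a b) * (l * (Im p - Im q)) = corner n v a"
    "Re q * Im p - Re p * Im q = d_a n v a b * - l * (Im p - Im q)"
    unfolding c by (simp_all add: algebra_simps)
qed

text \<open>With l the half length of the diagonal and h the height difference of the two neighbours,
  \<open>(1 - d_a) l h\<close> is the corner's cross product. The lower bound uses that l and h are at most
  1; the upper bound that the cross product is h times the abscissa, relative to a, of a point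
  between the neighbours, hence at most h.\<close>

lemma one_minus_d_a_bounds:
  assumes "convex_polygon_ccw n v" "{a, b} \<in> D_set n" "a < n" "b < n"
    and diam: "diameter (polygon n v) = 1"
    and sep: "d < cmod (v b - v a)" "0 < d"
  shows "corner n v a \<le> 1 - d_a n v a b" "1 - d_a n v a b \<le> 2 / d"
proof -
  define T l where "T = diag_frame (v a) (v b)" and "l = diag_l (v a) (v b)"
  define p q where "p = T (v (prv n a))" and "q = T (v (nxt n a))"
  define g h where "g = 1 - d_a n v a b" and "h = Im p - Im q"
  note frame = diagonal_frame[OF assms(1-4), folded T_def l_def, folded p_def q_def,
      folded g_def h_def]
  have le1: "cmod (v i - v j) \<le> 1" if "i < n" "j < n" for i j
    unfolding diam[symmetric] using that by (intro dist_polygon_le_diameter vertex_in_polygon)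
  have l: "0 < l" "d / 2 \<le> l" "l \<le> 1" using frame(2,3) sep le1[of b a] assms by auto
  have len: "cmod (q - T (v a)) \<le> 1" "cmod (p - T (v a)) \<le> 1" "cmod (p - q) \<le> 1"
    unfolding p_def q_def frame(4)
    using assms(3) by (intro le1 nxt_less prv_less; simp)+
  have h: "0 < h" "h \<le> 1"
    using frame(5,6) abs_Im_le_cmod[of "p - q"] len(3) by (auto simp: h_def)
  have C: "0 < corner n v a" by (rule corner_pos) fact+
  have eq: "g * (l * h) = corner n v a" by (rule frame(7))
  have g: "0 < g" using eq C l(1) h(1) by (metis mult_pos_pos zero_less_mult_pos2)
  have "g * (l * h) \<le> g * (1 * 1)"
    using g l h by (intro mult_left_mono mult_mono) auto
  then have "corner n v a \<le> g" unfolding eq by simp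
  then show "corner n v a \<le> 1 - d_a n v a b" by (simp add: g_def)
  have re: "Re q + l \<le> 1" "Re p + l \<le> 1"
    using len(1,2) abs_Re_le_cmod[of "q - T (v a)"] abs_Re_le_cmod[of "p - T (v a)"]
    by (auto simp: frame(1))
  have "g * l * h = h * l + (Re q * Im p - Re p * Im q)"
    unfolding frame(8) g_def by (simp add: algebra_simps)
  also have "\<dots> = (Re q + l) * Im p + (Re p + l) * (- Im q)"
    by (simp add: h_def algebra_simps)
  also have "\<dots> \<le> 1 * Im p + 1 * (- Im q)"
    using re frame(5,6) by (intro add_mono mult_right_mono) auto
  finally have "g * l * h \<le> 1 * h" by (simp add: h_def)
  then have "g * l \<le> 1" using h(1) by (rule mult_right_le_imp_le)
  moreover have "g * (d / 2) \<le> g * l" using g l by (intro mult_left_mono) auto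
  ultimately have "g * (d / 2) \<le> 1" by linarith
  then show "1 - d_a n v a b \<le> 2 / d" using sep(2) by (simp add: g_def field_simps)
qed

lemma diagonal_edge_coeffs_bounded:
  assumes "convex_polygon_ccw n v" "{a, b} \<in> D_set n" "a < n" "b < n" "0 \<le> s"
  defines "T \<equiv> diag_frame (v a) (v b)"
  defines "c \<equiv> edge_coeffs s (d_a n v a b) (T (v (prv n a))) (T (v a)) (T (v (nxt n a)))"
  shows "\<bar>fst c\<bar> \<le> s" "\<bar>snd c\<bar> \<le> s"
proof -
  note frame = diagonal_frame[OF assms(1-4), folded T_def]
  have "Im (T (v a)) = 0" "Re (T (v a)) = - diag_l (v a) (v b)" by (simp_all add: frame(1))
  then show "\<bar>fst c\<bar> \<le> s" "\<bar>snd c\<bar> \<le> s"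
    unfolding c_def using frame(5,6,8) assms(5) by (intro edge_coeffs_bounded; simp only:)+
qed

text \<open>Both \<open>1 - da\<close> and \<open>1 - db\<close> lie between \<open>\<kappa>\<close> and \<open>2 / d\<close>. So the common denominator
  is at least \<open>2 * \<kappa>\<close>, and \<open>2 + 2 * da = 4 - 2 * (1 - da)\<close> has absolute value at most
  \<open>4 + 4 / d\<close>. The bound for the vertex entries is the larger one and also covers \<open>s\<close>.\<close>

lemma abs_diag_coeff_le:
  assumes conv: "convex_polygon_ccw n v" and D: "{a, b} \<in> D_set n" "a < n" "b < n"
    and diam: "diameter (polygon n v) = 1"
    and sep: "d < cmod (v b - v a)" "0 < d"
    and corner: "\<kappa> \<le> corner n v a" "\<kappa> \<le> corner n v b" "0 < \<kappa>"
  shows "\<bar>diag_coeff n v a b ij\<bar> \<le> (2 + 2 / d) / \<kappa>"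
proof -
  have ne: "v a \<noteq> v b" by (rule diagonal_vertices_distinct) fact+
  have D': "{b, a} \<in> D_set n" using D by (simp add: insert_commute)
  define da db where "da = d_a n v a b" and "db = d_b n v a b"
  define s where "s = diag_s n v a b"
  define w where "w = diag_frame (v a) (v b) \<circ> v"
  have db: "d_a n v b a = db" using d_swap[OF ne] by (simp add: db_def)
  have ga: "\<kappa> \<le> 1 - da" "1 - da \<le> 2 / d"
    using one_minus_d_a_bounds[OF conv D diam sep] corner by (auto simp: da_def)
  have gb: "\<kappa> \<le> 1 - db" "1 - db \<le> 2 / d"
    using one_minus_d_a_bounds[OF conv D' D(3,2) diam _ sep(2)] sep(1) corner
    by (auto simp: norm_minus_commute db)
  have den: "2 * \<kappa> \<le> 2 - (da + db)" using ga gb by linarith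
  have s: "s = 2 / (2 - (da + db))" by (simp add: s_def diag_s_def da_def db_def)
  have "2 / (2 - (da + db)) \<le> 2 / (2 * \<kappa>)" using den corner(3) by (intro divide_left_mono) auto
  then have s_le: "0 \<le> s" "s \<le> 1 / \<kappa>" using den corner(3) by (auto simp: s)
  have "1 \<le> 2 + 2 / d" using sep(2) by simp
  then have "1 / \<kappa> \<le> (2 + 2 / d) / \<kappa>"
    using corner(3) by (intro divide_right_mono) auto
  then have s_K: "s \<le> (2 + 2 / d) / \<kappa>" using s_le by linarith
  have Kpos: "0 \<le> (2 + 2 / d) / \<kappa>" using sep(2) corner(3) by simp
  have ca: "\<bar>fst (edge_coeffs s da (w (prv n a)) (w a) (w (nxt n a)))\<bar> \<le> s"
    "\<bar>snd (edge_coeffs s da (w (prv n a)) (w a) (w (nxt n a)))\<bar> \<le> s"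
    unfolding w_def o_def da_def
    by (rule diagonal_edge_coeffs_bounded[OF conv D s_le(1)])+
  \<comment> \<open>the frame of the reversed diagonal is the negative one, which changes no coefficient\<close>
  have "edge_coeffs s db (w (prv n b)) (w b) (w (nxt n b)) = edge_coeffs s db
      (diag_frame (v b) (v a) (v (prv n b))) (diag_frame (v b) (v a) (v b))
      (diag_frame (v b) (v a) (v (nxt n b)))"
    unfolding diag_frame_swap[OF ne] w_def o_def edge_coeffs_uminus ..
  then have cb: "\<bar>fst (edge_coeffs s db (w (prv n b)) (w b) (w (nxt n b)))\<bar> \<le> s"
    "\<bar>snd (edge_coeffs s db (w (prv n b)) (w b) (w (nxt n b)))\<bar> \<le> s"
    using diagonal_edge_coeffs_bounded[OF conv D' D(3,2) s_le(1)] by (simp_all only: db)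
  have vertex: "\<bar>(- 2 - 2 * x) / (2 - (da + db))\<bar> \<le> (2 + 2 / d) / \<kappa>"
    if "\<kappa> \<le> 1 - x" "1 - x \<le> 2 / d" for x
  proof -
    have "\<bar>- 2 - 2 * x\<bar> \<le> 4 + 2 * (2 / d)" using that corner(3) by linarith
    then have "\<bar>- 2 - 2 * x\<bar> / (2 - (da + db)) \<le> (4 + 2 * (2 / d)) / (2 * \<kappa>)"
      using den corner(3) by (intro frac_le) auto
    also have "\<dots> = (2 + 2 / d) / \<kappa>" using corner(3) by (simp add: field_simps)
    finally show ?thesis using den corner(3) by simp
  qed
  \<comment> \<open>every branch of the case distinction over the row index obeys the same bound\<close>
  have split: "\<bar>if P then x else y\<bar> \<le> K" if "\<bar>x\<bar> \<le> K" "\<bar>y\<bar> \<le> K" for P and x y K :: real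
    using that by simp
  have zero: "\<bar>0\<bar> \<le> (2 + 2 / d) / \<kappa>" using Kpos by simp
  show ?thesis
    unfolding diag_coeff_def Let_def w_def[symmetric] da_def[symmetric] db_def[symmetric]
      s_def[symmetric]
    by (intro split order_trans[OF ca(1) s_K] order_trans[OF ca(2) s_K]
        order_trans[OF cb(1) s_K] order_trans[OF cb(2) s_K] vertex[OF ga] vertex[OF gb] zero)
qed

lemma card_I_set_le: "card (I_set n) \<le> n * n"
proof -
  have I: "I_set n = (\<lambda>(a, b). {a, b}) ` ({..<n} \<times> {..<n})" by (auto simp: I_set_def)
  have "card (I_set n) \<le> card ({..<n} \<times> {..<n})" unfolding I by (rule card_image_le) simp
  then show "card (I_set n) \<le> n * n" by simp
qed

lemma matrix_norm_le:
  assumes "0 < n" "\<And>ij ab. ab \<in> I_set n \<Longrightarrow> \<bar>A ij ab\<bar> \<le> c"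
  shows "matrix_norm n A \<le> real (n * n) * c"
proof -
  have V: "V_set n = (\<lambda>a. {a, a}) ` {..<n}" and E: "E_set n = (\<lambda>a. {a, nxt n a}) ` {..<n}"
    by (auto simp: V_set_def E_set_def)
  have "{0, 0} \<in> I_set n" using assms(1) by (auto simp: I_set_def)
  then have "0 \<le> c" using assms(2) by (meson abs_ge_zero order_trans)
  have "(\<Sum>ab\<in>I_set n. \<bar>A ij ab\<bar>) \<le> real (n * n) * c" for ij
  proof -
    have "(\<Sum>ab\<in>I_set n. \<bar>A ij ab\<bar>) \<le> real (card (I_set n)) * c"
      using assms(2) by (intro sum_bounded_above) auto
    also have "\<dots> \<le> real (n * n) * c"
      using card_I_set_le \<open>0 \<le> c\<close> by (intro mult_right_mono of_nat_mono)
    finally show ?thesis .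
  qed
  then show ?thesis
    unfolding matrix_norm_def V E using assms(1) by (subst Max_le_iff) auto
qed

theorem theorem5p3:
  fixes \<gamma>s ds \<beta>s :: real
  assumes "\<gamma>s > 0" and "ds > 0" and "\<beta>s < pi"
  shows "\<exists>K>0. \<forall>(n::nat) (v :: nat \<Rightarrow> complex).
           convex_polygon_ccw n v \<longrightarrow>
           diameter (polygon n v) = 1 \<longrightarrow>
           aspect_ratio (polygon n v) < \<gamma>s \<longrightarrow>
           (\<forall>i<n. \<forall>j<n. i \<noteq> j \<longrightarrow> cmod (v i - v j) > ds) \<longrightarrow>
           (\<forall>i<n. interior_angle n v i < \<beta>s) \<longrightarrow>
           matrix_norm n (coeff_matrix n v) \<le> K"
proof -
  obtain N where N: "\<And>n (w :: nat \<Rightarrow> complex). \<forall>i<n. cmod (w i - w 0) \<le> 1 \<Longrightarrow>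
      \<forall>i<n. \<forall>j<n. i \<noteq> j \<longrightarrow> ds < cmod (w i - w j) \<Longrightarrow> n \<le> N"
    using separated_points_bounded_number[OF assms(2), of 1] by blast
  define \<kappa> where "\<kappa> = corner_bound \<gamma>s ds \<beta>s"
  have \<kappa>: "0 < \<kappa>" unfolding \<kappa>_def by (rule corner_bound_pos) fact+
  \<comment> \<open>the summand 1 covers the columns of vertices and edges\<close>
  define c where "c = 1 + (2 + 2 / ds) / \<kappa>"
  have c: "1 \<le> c" using \<kappa> assms(2) by (simp add: c_def)
  show ?thesis
  proof (intro exI[of _ "real (N * N) * c + 1"] conjI allI impI)
    show "0 < real (N * N) * c + 1" using c by (smt (verit) mult_nonneg_nonneg of_nat_0_le_iff)
    fix n v
    assume conv: "convex_polygon_ccw n v" and diam: "diameter (polygon n v) = 1"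
      and aspect: "aspect_ratio (polygon n v) < \<gamma>s"
      and sep: "\<forall>i<n. \<forall>j<n. i \<noteq> j \<longrightarrow> cmod (v i - v j) > ds"
      and angle: "\<forall>i<n. interior_angle n v i < \<beta>s"
    have n: "0 < n" using conv by (simp add: convex_polygon_ccw_def)
    have corner: "\<kappa> \<le> corner n v i" if "i < n" for i
      unfolding \<kappa>_def using that assms angle
      by (intro corner_ge_corner_bound[OF conv diam aspect _ sep]) auto
    have entry: "\<bar>coeff_matrix n v ij ab\<bar> \<le> c" if "ab \<in> I_set n" for ij ab
    proof (cases "ab \<in> V_set n \<union> E_set n")
      case True
      then show ?thesis using c by (simp add: coeff_matrix_def)
    next
      case False
      define a b where "a = Min ab" and "b = Max ab"
      obtain x y where xy: "ab = {x, y}" "x < n" "y < n"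
        using \<open>ab \<in> I_set n\<close> unfolding I_set_def by blast
      then have ab: "{a, b} = ab" "a < n" "b < n"
        by (cases "x \<le> y"; auto simp: a_def b_def)+
      have D: "{a, b} \<in> D_set n" using that False by (simp add: ab(1) D_set_def)
      have "\<bar>diag_coeff n v a b ij\<bar> \<le> (2 + 2 / ds) / \<kappa>"
        using sep diagonal_neighbours(1)[OF D ab(2,3)] ab(2,3) assms(2) corner \<kappa>
        by (intro abs_diag_coeff_le[OF conv D ab(2,3) diam]) auto
      then show ?thesis using False by (simp add: coeff_matrix_def c_def a_def b_def)
    qed
    have "n \<le> N"
    proof (rule N)
      show "\<forall>i<n. cmod (v i - v 0) \<le> 1"
        unfolding diam[symmetric] using n by (auto intro!: dist_polygon_le_diameter vertex_in_polygon)
    qed (use sep in simp)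
    have "matrix_norm n (coeff_matrix n v) \<le> real (n * n) * c"
      using n entry by (rule matrix_norm_le)
    also have "\<dots> \<le> real (N * N) * c"
      using c \<open>n \<le> N\<close> by (intro mult_right_mono of_nat_mono mult_le_mono) auto
    finally show "matrix_norm n (coeff_matrix n v) \<le> real (N * N) * c + 1" by simp
  qed
qed

end
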